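(* Let $T$ be a tree with its path metric and let $f\colon T\to T$ be a nonexpansive bijection. Then $f$ carries geodesics to geodesics: if $v_0,v_1,\dots,v_n$ is a geodesic in $T$, then $f(v_0),f(v_1),\dots,f(v_n)$ is a geodesic in $T$. Consequently $f$ is an isometry, and every tree is plastic.
   Context: A tree is a connected acyclic (simple, undirected, unweighted) graph, not assumed locally finite. It is identified with its vertex set and equipped with the path metric $d(u,v)$ = minimal length of a walk from $u$ to $v$. A geodesic from $u$ to $v$ is a walk from $u$ to $v$ of length $d(u,v)$ (it is automatically a path). A map $f$ is nonexpansive if $d(f(x),f(y))\le d(x,y)$ for all $x,y$. A metric space is plastic if every bijective nonexpansive self-map is an isometry. *)

theory Defs
  imports
    "HOL-Analysis.Abstract_Metric_Spaces"
    "Graph_Theory.Graph_Theory"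
begin

text \<open>
  An undirected simple graph is a symmetric loop-free digraph without parallel arcs; the locale
  \<^verbatim>\<open>pair_bidirected_digraph\<close> imposes no finiteness. The library predicate \<^verbatim>\<open>tree\<close> cannot be
  used, because its \<^verbatim>\<open>forest\<close> counts the closed walk \<^verbatim>\<open>a, b, a\<close> along a single edge as a cycle.
  Cycles of an undirected graph have at least three edges. As usual in the library,
  \<^verbatim>\<open>connected\<close> includes having at least one vertex.
\<close>

definition undirected_cycle :: "'a pair_pre_digraph \<Rightarrow> 'a vwalk \<Rightarrow> bool" where
  "undirected_cycle G p \<longleftrightarrow>
     vwalk p (with_proj G) \<and> hd p = last p \<and> distinct (tl p) \<and> 3 \<le> vwalk_length p"

definition undirected_tree :: "'a pair_pre_digraph \<Rightarrow> bool" where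
  "undirected_tree T \<longleftrightarrow>
     pair_bidirected_digraph T \<and> Digraph_Component.connected (with_proj T)
     \<and> \<not> (\<exists>p. undirected_cycle T p)"

definition path_dist :: "'a pair_pre_digraph \<Rightarrow> 'a \<Rightarrow> 'a \<Rightarrow> nat" where
  "path_dist G u v =
     (LEAST n. \<exists>p. vwalk p (with_proj G) \<and> hd p = u \<and> last p = v \<and> vwalk_length p = n)"

definition path_metric :: "'a pair_pre_digraph \<Rightarrow> 'a \<Rightarrow> 'a \<Rightarrow> real" where
  "path_metric G u v = real (path_dist G u v)"

definition geodesic :: "'a pair_pre_digraph \<Rightarrow> 'a vwalk \<Rightarrow> bool" where
  "geodesic G p \<longleftrightarrow> vwalk p (with_proj G) \<and> vwalk_length p = path_dist G (hd p) (last p)"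

definition nonexpansive_on :: "'a set \<Rightarrow> ('a \<Rightarrow> 'a \<Rightarrow> real) \<Rightarrow> ('a \<Rightarrow> 'a) \<Rightarrow> bool" where
  "nonexpansive_on M d f \<longleftrightarrow> f \<in> M \<rightarrow> M \<and> (\<forall>x\<in>M. \<forall>y\<in>M. d (f x) (f y) \<le> d x y)"

definition isometry_on :: "'a set \<Rightarrow> ('a \<Rightarrow> 'a \<Rightarrow> real) \<Rightarrow> ('a \<Rightarrow> 'a) \<Rightarrow> bool" where
  "isometry_on M d f \<longleftrightarrow> bij_betw f M M \<and> (\<forall>x\<in>M. \<forall>y\<in>M. d (f x) (f y) = d x y)"

definition plastic :: "'a set \<Rightarrow> ('a \<Rightarrow> 'a \<Rightarrow> real) \<Rightarrow> bool" where
  "plastic M d \<longleftrightarrow> Metric_space M d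
     \<and> (\<forall>f. bij_betw f M M \<and> nonexpansive_on M d f \<longrightarrow> isometry_on M d f)"

end

theory Submission
  imports Defs
begin

text \<open>
  Two vertices are adjacent exactly when they are distinct and at distance at most one. An injective
  nonexpansive map therefore sends adjacent vertices to adjacent vertices, hence walks to walks, and
  by injectivity it sends paths (walks without repeated vertices) to paths.

  This suffices because in a tree the geodesics are exactly the paths. A geodesic never repeats a
  vertex, since the part between two visits could be cut out (\<^verbatim>\<open>geodesic_imp_vpath\<close>). Conversely,
  two different paths with common ends would first diverge and then meet again, which closes a cycle
  (\<^verbatim>\<open>undirected_cycle_of_fork\<close>); so a path is the only path between its ends
  (\<^verbatim>\<open>undirected_tree_vpath_unique\<close>), and it coincides with the geodesic that connectedness provides.

  So the image of a geodesic is a geodesic with the same number of edges, and distances are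
  preserved. In particular the tree is plastic.
\<close>

section \<open>The path metric of a connected symmetric graph\<close>

text \<open>
  This form of the definition of a walk makes the library facts on \<^const>\<open>successively\<close> for
  concatenation and mapping available for walks.
\<close>
lemma vwalk_iff_successively:
  "vwalk p (with_proj G) \<longleftrightarrow>
     p \<noteq> [] \<and> set p \<subseteq> pverts G \<and> successively (\<lambda>u v. (u, v) \<in> parcs G) p"
proof -
  have "set (vwalk_arcs p) \<subseteq> parcs G \<longleftrightarrow> successively (\<lambda>u v. (u, v) \<in> parcs G) p"
    by (induction p rule: vwalk_arcs.induct) auto
  then show ?thesis
    by (auto simp: vwalk_def)
qed

lemma path_dist_le:
  assumes "vwalk p (with_proj G)"
  shows "path_dist G (hd p) (last p) \<le> vwalk_length p"
  unfolding path_dist_def by (rule Least_le) (use assms in blast)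

lemma path_dist_self:
  assumes "u \<in> pverts G"
  shows "path_dist G u u = 0"
  using path_dist_le[of "[u]" G] assms by simp

text \<open>If a vertex occurred twice, cutting out the detour between the two visits would shorten the walk.\<close>
lemma geodesic_imp_vpath:
  assumes "geodesic G p"
  shows "vpath p (with_proj G)"
proof
  show walk: "vwalk p (with_proj G)"
    using assms by (simp add: geodesic_def)
  show "distinct p"
  proof (rule ccontr)
    assume "\<not> distinct p"
    then obtain xs ys zs y where p: "p = xs @ [y] @ ys @ [y] @ zs"
      using not_distinct_decomp by blast
    let ?q = "xs @ [y] @ zs"
    have "vwalk ?q (with_proj G)"
      using walk by (auto simp: vwalk_iff_successively p successively_append_iff successively_Cons)
    moreover have "hd ?q = hd p" "last ?q = last p"
      by (auto simp: p hd_append)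
    ultimately have "path_dist G (hd p) (last p) \<le> vwalk_length ?q"
      using path_dist_le by metis
    then show False
      using assms by (simp add: geodesic_def p)
  qed
qed

context pair_sym_digraph
begin

lemma vwalk_rev:
  assumes "vwalk p (with_proj G)"
  shows "vwalk (rev p) (with_proj G)"
  using vwalk_rev_ex[OF pair_sym_arcs assms] .

text \<open>
  Reversal turns the walks from \<^term>\<open>u\<close> to \<^term>\<open>v\<close> into those from \<^term>\<open>v\<close> to \<^term>\<open>u\<close>. The
  equation is unconditional: when no walk joins the two points, both sides are the least
  number with the same unsatisfiable property, hence the same unspecified value.
\<close>
lemma path_dist_commute: "path_dist G u v = path_dist G v u"
proof -
  have swap: "\<exists>p. vwalk p (with_proj G) \<and> hd p = y \<and> last p = x \<and> vwalk_length p = n"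
    if walk: "\<exists>p. vwalk p (with_proj G) \<and> hd p = x \<and> last p = y \<and> vwalk_length p = n" for x y n
  proof -
    obtain p where p: "vwalk p (with_proj G)" "hd p = x" "last p = y" "vwalk_length p = n"
      using walk by blast
    then have "p \<noteq> []"
      by auto
    then show ?thesis
      using p vwalk_rev[OF p(1)] by (intro exI[of _ "rev p"]) (simp add: hd_rev last_rev)
  qed
  have "(\<exists>p. vwalk p (with_proj G) \<and> hd p = u \<and> last p = v \<and> vwalk_length p = n) \<longleftrightarrow>
        (\<exists>p. vwalk p (with_proj G) \<and> hd p = v \<and> last p = u \<and> vwalk_length p = n)" for n
    using swap[of u v n] swap[of v u n] by (rule iffI)
  then show ?thesis
    by (simp add: path_dist_def)
qed

lemma connected_geodesic_exists:
  assumes "Digraph_Component.connected (with_proj G)" "u \<in> pverts G" "v \<in> pverts G"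
  obtains p where "geodesic G p" "hd p = u" "last p = v"
proof -
  have "u \<rightarrow>\<^sup>*\<^bsub>with_proj G\<^esub> v"
    using symmetric_connected_imp_strongly_connected[OF pair_sym_arcs assms(1)] assms(2,3)
    by (auto simp: strongly_connected_def)
  then have "\<exists>n p. vwalk p (with_proj G) \<and> hd p = u \<and> last p = v \<and> vwalk_length p = n"
    by (auto simp: reachable_vwalk_conv)
  then have "\<exists>p. vwalk p (with_proj G) \<and> hd p = u \<and> last p = v \<and> vwalk_length p = path_dist G u v"
    unfolding path_dist_def by (rule LeastI_ex)
  then show ?thesis
    using that by (auto simp: geodesic_def)
qed

lemma Metric_space_path_metric:
  assumes conn: "Digraph_Component.connected (with_proj G)"
  shows "Metric_space (pverts G) (path_metric G)"
proof
  show "path_metric G x y = path_metric G y x" for x y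
    by (simp add: path_metric_def path_dist_commute)
next
  fix x y
  assume xy: "x \<in> pverts G" "y \<in> pverts G"
  obtain p where p: "geodesic G p" "hd p = x" "last p = y"
    using connected_geodesic_exists[OF conn xy] .
  have "x = y" if "path_dist G x y = 0"
    using that p by (cases p) (auto simp: geodesic_def)
  then show "path_metric G x y = 0 \<longleftrightarrow> x = y"
    using xy path_dist_self by (auto simp: path_metric_def)
next
  fix x y z
  assume xyz: "x \<in> pverts G" "y \<in> pverts G" "z \<in> pverts G"
  obtain p where p: "geodesic G p" "hd p = x" "last p = y"
    using connected_geodesic_exists[OF conn xyz(1,2)] .
  obtain q where q: "geodesic G q" "hd q = y" "last q = z"
    using connected_geodesic_exists[OF conn xyz(2,3)] .
  have walks: "vwalk p (with_proj G)" "vwalk q (with_proj G)"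
    using p q by (simp_all add: geodesic_def)
  then have join: "joinable p q"
    using p q by auto
  have "path_dist G x z \<le> vwalk_length (p \<oplus> q)"
    using path_dist_le[OF vwalk_joinI_vwalk[OF walks join]] p q join
    by (simp add: vwalk_join_hd vwalk_join_last)
  also have "\<dots> = path_dist G x y + path_dist G y z"
    using p q vwalk_join_vwalk_length[OF join] by (simp add: geodesic_def)
  finally show "path_metric G x z \<le> path_metric G x y + path_metric G y z"
    by (simp add: path_metric_def)
qed (simp add: path_metric_def)

lemma path_dist_arc:
  assumes "(u, v) \<in> parcs G"
  shows "path_dist G u v \<le> 1"
proof -
  have "u \<in> pverts G" "v \<in> pverts G"
    using assms by (auto dest: arc_fst_in_verts arc_snd_in_verts)
  then show ?thesis
    using path_dist_le[of "[u, v]" G] assms by (simp add: vwalk_iff_successively)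
qed

lemma arc_of_path_dist_le_1:
  assumes "Digraph_Component.connected (with_proj G)" "u \<in> pverts G" "v \<in> pverts G"
    and "path_dist G u v \<le> 1" "u \<noteq> v"
  shows "(u, v) \<in> parcs G"
proof -
  obtain p where p: "geodesic G p" "hd p = u" "last p = v"
    using connected_geodesic_exists[OF assms(1-3)] .
  then have "length p \<le> 2" "vwalk p (with_proj G)"
    using assms(4) by (auto simp: geodesic_def)
  then have "p = [u, v]"
    using p \<open>u \<noteq> v\<close> by (cases p; cases "tl p") (auto simp: vwalk_iff_successively)
  then show ?thesis
    using \<open>vwalk p _\<close> by (simp add: vwalk_iff_successively)
qed

end

section \<open>Paths in trees\<close>

text \<open>
  Let \<^term>\<open>x\<close> be the first vertex after \<^term>\<open>u\<close> on the second path that also lies on the first one;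
  it exists because the final vertices agree. Following the first path from \<^term>\<open>u\<close> to \<^term>\<open>x\<close> and the
  second one back is a closed walk without repetitions. Its length is at least three because the
  two paths leave \<^term>\<open>u\<close> towards different vertices.
\<close>
lemma (in pair_sym_digraph) undirected_cycle_of_fork:
  assumes p: "vpath (u # a # p) (with_proj G)" and q: "vpath (u # b # q) (with_proj G)"
    and "last (a # p) = last (b # q)" "a \<noteq> b"
  shows "\<exists>c. undirected_cycle G c"
proof -
  have "last (b # q) \<in> set (a # p)"
    using assms(3) last_in_set[of "a # p"] by simp
  then have "\<exists>x\<in>set (b # q). x \<in> set (a # p)"
    using last_in_set[of "b # q"] by blast
  then obtain ys x zs where bq: "b # q = ys @ x # zs" and x: "x \<in> set (a # p)"
    and ys: "\<forall>y\<in>set ys. y \<notin> set (a # p)"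
    by (rule split_list_first_propE)
  obtain as bs where ap: "a # p = as @ x # bs"
    using split_list[OF x] by blast
  let ?c = "(u # as @ [x]) @ rev (u # ys)"
  have up: "vwalk (u # as @ x # bs) (with_proj G)" and uq: "vwalk (u # ys @ x # zs) (with_proj G)"
    and dist: "distinct (u # as @ x # bs)" "distinct (u # ys @ x # zs)"
    using p q by (auto simp: vpath_def ap bq)
  have walk1: "vwalk (u # as @ [x]) (with_proj G)"
    using up vwalkI_append_l[of "u # as @ [x]" bs] by simp
  have "vwalk (u # ys @ [x]) (with_proj G)"
    using uq vwalkI_append_l[of "u # ys @ [x]" zs] by simp
  then have walk2: "vwalk (x # rev (u # ys)) (with_proj G)"
    using vwalk_rev[of "u # ys @ [x]"] by simp
  have "vwalk ((u # as @ [x]) \<oplus> (x # rev (u # ys))) (with_proj G)"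
    using walk1 walk2 by (intro vwalk_joinI_vwalk) simp_all
  then have "vwalk ?c (with_proj G)"
    by (simp add: vwalk_join_def)
  moreover have "distinct (tl ?c)"
    using dist ys by (auto simp: ap)
  moreover have "as \<noteq> [] \<or> ys \<noteq> []"
    using ap bq \<open>a \<noteq> b\<close> by auto
  then have "3 \<le> vwalk_length ?c"
    by (cases as; cases ys) auto
  ultimately show ?thesis
    unfolding undirected_cycle_def by (intro exI[of _ ?c]) simp
qed

lemma undirected_tree_vpath_unique:
  assumes tree: "undirected_tree T"
    and "vpath p (with_proj T)" "vpath q (with_proj T)" "hd p = hd q" "last p = last q"
  shows "p = q"
  using assms(2-)
proof (induction p arbitrary: q)
  case Nil
  then show ?case
    by (simp add: vpath_def vwalk_def)
next
  case (Cons u p)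
  interpret pair_bidirected_digraph T
    using tree by (simp add: undirected_tree_def)
  obtain q' where q: "q = u # q'"
    using Cons.prems by (cases q) (auto simp: vpath_def vwalk_def)
  \<comment> \<open>A path that ends where it starts is a single vertex.\<close>
  have ends: "p = [] \<longleftrightarrow> q' = []"
    using Cons.prems last_in_set[of p] last_in_set[of q'] by (auto simp: q vpath_def split: if_splits)
  show ?case
  proof (cases p)
    case Nil
    then show ?thesis
      using ends q by simp
  next
    case p: (Cons a p')
    obtain b q'' where q': "q' = b # q''"
      using ends p by (cases q') auto
    have "a = b"
    proof (rule ccontr)
      assume "a \<noteq> b"
      then have "\<exists>c. undirected_cycle T c"
        using undirected_cycle_of_fork[of u a p' b q''] Cons.prems by (simp add: p q q')
      then show False
        using tree by (simp add: undirected_tree_def)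
    qed
    moreover have "vpath p (with_proj T)" "vpath q' (with_proj T)"
      using Cons.prems by (auto simp: vpath_def p q q' vwalk_iff_successively)
    ultimately have "p = q'"
      using Cons.IH[of q'] Cons.prems by (simp add: p q q')
    then show ?thesis
      by (simp add: q)
  qed
qed

lemma undirected_tree_vpath_imp_geodesic:
  assumes tree: "undirected_tree T" and p: "vpath p (with_proj T)"
  shows "geodesic T p"
proof -
  interpret pair_bidirected_digraph T
    using tree by (simp add: undirected_tree_def)
  have "hd p \<in> pverts T" "last p \<in> pverts T"
    using p by (auto simp: vpath_def vwalk_def subset_iff)
  then obtain q where q: "geodesic T q" "hd q = hd p" "last q = last p"
    using connected_geodesic_exists tree by (auto simp: undirected_tree_def)
  then have "q = p"
    using undirected_tree_vpath_unique[OF tree geodesic_imp_vpath p] by blast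
  then show ?thesis
    using q by simp
qed

section \<open>Nonexpansive maps of trees\<close>

lemma undirected_tree_nonexpansive_geodesic:
  assumes tree: "undirected_tree T" and inj: "inj_on f (pverts T)"
    and f: "nonexpansive_on (pverts T) (path_metric T) f" and vs: "geodesic T vs"
  shows "geodesic T (map f vs)"
proof -
  interpret pair_bidirected_digraph T
    using tree by (simp add: undirected_tree_def)
  have arc: "(f u, f v) \<in> parcs T" if uv: "(u, v) \<in> parcs T" for u v
  proof -
    have verts: "u \<in> pverts T" "v \<in> pverts T"
      using uv by (auto dest: arc_fst_in_verts arc_snd_in_verts)
    then have "path_dist T (f u) (f v) \<le> path_dist T u v" "f u \<in> pverts T" "f v \<in> pverts T"
      using f by (auto simp: nonexpansive_on_def path_metric_def)
    moreover have "f u \<noteq> f v"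
      using inj verts no_loops'[OF uv] by (auto dest: inj_onD)
    ultimately show ?thesis
      using arc_of_path_dist_le_1[of "f u" "f v"] path_dist_arc[OF uv] tree
      by (simp add: undirected_tree_def)
  qed
  have path: "vpath vs (with_proj T)"
    using geodesic_imp_vpath[OF vs] .
  then have verts: "set vs \<subseteq> pverts T" "distinct vs"
    by (auto simp: vpath_def vwalk_def)
  have "successively (\<lambda>u v. (u, v) \<in> parcs T) vs"
    using path by (simp add: vpath_def vwalk_iff_successively)
  then have "successively (\<lambda>u v. (u, v) \<in> parcs T) (map f vs)"
    unfolding successively_map by (rule successively_mono) (rule arc)
  then have "vwalk (map f vs) (with_proj T)"
    using path f by (auto simp: vpath_def vwalk_iff_successively nonexpansive_on_def)
  moreover have "distinct (map f vs)"
    using verts inj by (auto simp: distinct_map intro: inj_on_subset)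
  ultimately show ?thesis
    using undirected_tree_vpath_imp_geodesic[OF tree] by (simp add: vpath_def)
qed

lemma undirected_tree_nonexpansive_bij_isometry:
  assumes tree: "undirected_tree T" and bij: "bij_betw f (pverts T) (pverts T)"
    and f: "nonexpansive_on (pverts T) (path_metric T) f"
  shows "isometry_on (pverts T) (path_metric T) f"
proof -
  interpret pair_bidirected_digraph T
    using tree by (simp add: undirected_tree_def)
  have "path_dist T (f x) (f y) = path_dist T x y" if xy: "x \<in> pverts T" "y \<in> pverts T" for x y
  proof -
    obtain p where p: "geodesic T p" "hd p = x" "last p = y"
      using connected_geodesic_exists xy tree by (auto simp: undirected_tree_def)
    then have "p \<noteq> []"
      by (auto simp: geodesic_def)
    moreover have "geodesic T (map f p)"
      using undirected_tree_nonexpansive_geodesic[OF tree bij_betw_imp_inj_on[OF bij] f p(1)] .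
    ultimately show ?thesis
      using p by (simp add: geodesic_def hd_map last_map)
  qed
  then show ?thesis
    using bij by (simp add: isometry_on_def path_metric_def)
qed

theorem proposition3p7:
  fixes T :: "'a pair_pre_digraph"
  assumes "undirected_tree T"
  shows "(\<forall>f. bij_betw f (pverts T) (pverts T) \<and> nonexpansive_on (pverts T) (path_metric T) f \<longrightarrow>
             (\<forall>vs. geodesic T vs \<longrightarrow> geodesic T (map f vs))
             \<and> isometry_on (pverts T) (path_metric T) f)
         \<and> plastic (pverts T) (path_metric T)"
proof -
  interpret pair_bidirected_digraph T
    using assms by (simp add: undirected_tree_def)
  have "Metric_space (pverts T) (path_metric T)"
    using Metric_space_path_metric assms by (simp add: undirected_tree_def)
  then show ?thesis
    using undirected_tree_nonexpansive_geodesic[OF assms]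
      undirected_tree_nonexpansive_bij_isometry[OF assms]
    by (auto simp: plastic_def dest: bij_betw_imp_inj_on)
qed

end
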